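(* Let $L_1,\ldots,L_8$ be general linear forms in $\mathbb{C}[x_0,\ldots,x_6]$ (i.e. general linear forms on $\mathbb{P}^6$). Then the ideal $I=(L_1^3,\ldots,L_8^3)\subset\mathbb{C}[x_0,\ldots,x_6]$ has the weak Lefschetz property (WLP) in degree $3$.
   Context: Let $R=\mathbb{C}[x_0,\ldots,x_6]$ with the standard grading, let $I=(L_1^3,\ldots,L_8^3)$, and let $A=R/I=\bigoplus_i A_i$ be the associated graded Artinian ring. The ideal $I$ has the weak Lefschetz property (WLP) in degree $i$ if, for a general linear form $L\in R_1$, the multiplication map $\times L: A_i\to A_{i+1}$ has maximal rank (i.e. is injective or surjective). "General linear forms $L_1,\ldots,L_8$" means that the assertion holds for all $(L_1,\ldots,L_8)$ in some nonempty Zariski open subset of $(R_1)^8$; similarly, "a general linear form $L$" means all $L$ in some nonempty Zariski open subset of $R_1$. *)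

theory Defs
  imports
    Complex_Main
    "HOL-Library.Poly_Mapping"
    "HOL-Library.Numeral_Type"
    "HOL-Algebra.Algebraic_Closure_Type"
begin

section \<open>Multivariate polynomials\<close>

text \<open>
  The polynomial ring with variables indexed by \<open>'v\<close> and coefficients in \<open>'k\<close> is the monoid
  algebra of the exponent vectors; the multiplication of \<^typ>\<open>('v \<Rightarrow>\<^sub>0 nat) \<Rightarrow>\<^sub>0 'k\<close> is the
  convolution product.
\<close>

type_synonym ('v, 'k) mpoly = "('v \<Rightarrow>\<^sub>0 nat) \<Rightarrow>\<^sub>0 'k"

definition monom_degree :: "('v \<Rightarrow>\<^sub>0 nat) \<Rightarrow> nat" where
  "monom_degree m = (\<Sum>i\<in>Poly_Mapping.keys m. Poly_Mapping.lookup m i)"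

definition homogeneous :: "nat \<Rightarrow> ('v, 'k::zero) mpoly set" where
  "homogeneous d = {p. \<forall>m\<in>Poly_Mapping.keys p. monom_degree m = d}"

definition mvar :: "'v \<Rightarrow> ('v, 'k::zero_neq_one) mpoly" where
  "mvar i = Poly_Mapping.single (Poly_Mapping.single i 1) 1"

definition mconst :: "'k::zero \<Rightarrow> ('v, 'k) mpoly" where
  "mconst a = Poly_Mapping.single 0 a"

definition linear_form :: "('v::finite \<Rightarrow> 'k::comm_ring_1) \<Rightarrow> ('v, 'k) mpoly" where
  "linear_form a = (\<Sum>i\<in>UNIV. mconst (a i) * mvar i)"

definition mpoly_eval :: "('v \<Rightarrow> 'k::comm_ring_1) \<Rightarrow> ('v, 'k) mpoly \<Rightarrow> 'k" where
  "mpoly_eval a p = (\<Sum>m\<in>Poly_Mapping.keys p. Poly_Mapping.lookup p m *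
     (\<Prod>i\<in>Poly_Mapping.keys m. a i ^ Poly_Mapping.lookup m i))"

section \<open>Genericity\<close>

text \<open>Affine space with coordinates indexed by the finite type \<open>'v\<close> is \<^typ>\<open>'v \<Rightarrow> 'k\<close>. A linear form is
  identified with its coefficient vector, and a tuple of \<open>r\<close> linear forms in \<open>n\<close> variables with a
  point of the affine space whose coordinates are indexed by \<open>r \<times> n\<close>.\<close>

definition zariski_closed :: "('v::finite \<Rightarrow> 'k::field) set \<Rightarrow> bool" where
  "zariski_closed Z \<longleftrightarrow> (\<exists>S. Z = {a. \<forall>p\<in>S. mpoly_eval a p = 0})"

definition zariski_open :: "('v::finite \<Rightarrow> 'k::field) set \<Rightarrow> bool" where
  "zariski_open U \<longleftrightarrow> zariski_closed (- U)"

definition holds_generically :: "(('v::finite \<Rightarrow> 'k::field) \<Rightarrow> bool) \<Rightarrow> bool" where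
  "holds_generically P \<longleftrightarrow> (\<exists>U. zariski_open U \<and> U \<noteq> {} \<and> (\<forall>a\<in>U. P a))"

section \<open>The weak Lefschetz property\<close>

abbreviation mpoly_ring :: "('v, 'k::comm_ring_1) mpoly ring" where
  "mpoly_ring \<equiv> ring_of_type_algebra"

text \<open>The degree \<open>d\<close> component of \<open>R/I\<close>: the classes of the forms of degree \<open>d\<close>.\<close>

definition graded_part :: "('v, 'k::comm_ring_1) mpoly set \<Rightarrow> nat \<Rightarrow> ('v, 'k) mpoly set set" where
  "graded_part I d = (\<lambda>f. I +>\<^bsub>mpoly_ring\<^esub> f) ` homogeneous d"

definition mult_map ::
    "('v, 'k::comm_ring_1) mpoly set \<Rightarrow> ('v, 'k) mpoly \<Rightarrow> ('v, 'k) mpoly set \<Rightarrow> ('v, 'k) mpoly set" where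
  "mult_map I f x = (I +>\<^bsub>mpoly_ring\<^esub> f) \<otimes>\<^bsub>mpoly_ring Quot I\<^esub> x"

definition WLP_in_degree :: "('v::finite, 'k::field) mpoly set \<Rightarrow> nat \<Rightarrow> bool" where
  "WLP_in_degree I d \<longleftrightarrow> holds_generically (\<lambda>l.
     inj_on (mult_map I (linear_form l)) (graded_part I d) \<or>
     mult_map I (linear_form l) ` graded_part I d = graded_part I (d + 1))"

end

theory Submission
  imports Defs "HOL-Analysis.Determinants"
begin

text \<open>
  Multiplication by a general linear form \<open>l\<close> is injective in degree three, and this holds for
  \<open>n + 1\<close> cubes in any number \<open>n \<ge> 5\<close> of variables. The form \<open>l\<close> together with \<open>n - 1\<close> of the given forms
  is a basis of the linear forms, so after a change of coordinates (\<open>cancel_linear_form\<close>) these \<open>n - 1\<close>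
  forms are variables \<open>x\<^sub>i\<close>, the form \<open>l\<close> is one more variable \<open>x\<^sub>z\<close>, and two forms \<open>A\<close>, \<open>B\<close> remain. If
  \<open>x\<^sub>z f\<close> lies in the ideal, say \<open>x\<^sub>z f = \<Sum> q\<^sub>i x\<^sub>i\<^sup>3 + s A\<^sup>3 + t B\<^sup>3\<close>, then the coefficients of
  \<open>x\<^sub>i\<^sup>2x\<^sub>j\<^sup>2\<close> and \<open>x\<^sub>i\<^sup>2x\<^sub>jx\<^sub>k\<close> give linear equations for the coefficients of \<open>s\<close> and \<open>t\<close> at the
  variables other than \<open>x\<^sub>z\<close>. In geometric terms, they say that the restrictions of the cubes to the
  hyperplane \<open>l = 0\<close> have no linear syzygy. The system has only the zero solution as
  soon as \<open>A\<close> and \<open>B\<close> have nonzero coordinates with pairwise distinct ratios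
  (\<open>quartic_system_trivial\<close>). So \<open>s\<close> and \<open>t\<close> are \<open>c x\<^sub>z\<close> and \<open>d x\<^sub>z\<close> in degree one, and cancelling \<open>x\<^sub>z\<close> shows that
  \<open>f - c A\<^sup>3 - d B\<^sup>3\<close> is in the monomial ideal of the \<open>x\<^sub>i\<^sup>3\<close> (\<open>cancel_variable\<close>).

  The conditions on the basis and on the coordinates of \<open>A\<close>, \<open>B\<close> become, by Cramer's rule, the
  non-vanishing of one polynomial \<open>general_position\<close> in the coefficients of all forms and of \<open>l\<close>. It is
  nonzero at an explicit point, so it defines a nonempty open set of tuples of forms for which some
  \<open>l\<close> works, and for each of these tuples a nonempty open set of \<open>l\<close>.
\<close>

(* Keeps the dollar sign unambiguous: it denotes vector components below. *)
no_notation fps_nth (infixl "$" 75)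

section \<open>Evaluation and substitution\<close>

lemma poly_mapping_additive_induct [case_names single add]:
  fixes p :: "'m \<Rightarrow>\<^sub>0 'k::comm_monoid_add"
  assumes single: "\<And>m c. P (Poly_Mapping.single m c)"
    and add: "\<And>p q. P p \<Longrightarrow> P q \<Longrightarrow> P (p + q)"
  shows "P p"
proof -
  have zero: "P 0" using single[of undefined 0] by simp
  have "P (\<Sum>m\<in>A. Poly_Mapping.single m (Poly_Mapping.lookup p m))" if "finite A" for A
    using that by (induction A) (auto intro: zero single add)
  moreover have "(\<Sum>m\<in>Poly_Mapping.keys p. Poly_Mapping.single m (Poly_Mapping.lookup p m)) = p"
    by (rule poly_mapping_eqI) 
      (auto simp: lookup_sum lookup_single when_def in_keys_iff)
  ultimately show ?thesis by (metis finite_keys)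
qed

definition monom_eval :: "('v::finite \<Rightarrow> 'b::comm_semiring_1) \<Rightarrow> ('v \<Rightarrow>\<^sub>0 nat) \<Rightarrow> 'b" where
  "monom_eval \<sigma> m = (\<Prod>i\<in>UNIV. \<sigma> i ^ Poly_Mapping.lookup m i)"

lemma monom_eval_add: "monom_eval \<sigma> (m + n) = monom_eval \<sigma> m * monom_eval \<sigma> n"
  by (simp add: monom_eval_def lookup_add power_add prod.distrib)

lemma monom_eval_0 [simp]: "monom_eval \<sigma> 0 = 1"
  by (simp add: monom_eval_def)

lemma monom_eval_single [simp]: "monom_eval \<sigma> (Poly_Mapping.single i n) = \<sigma> i ^ n"
  by (simp add: monom_eval_def lookup_single when_def if_distrib cong: if_cong)

lemma monom_eval_keys: "(\<Prod>i\<in>Poly_Mapping.keys m. \<sigma> i ^ Poly_Mapping.lookup m i) = monom_eval \<sigma> m"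
  unfolding monom_eval_def by (rule prod.mono_neutral_left) (auto simp: in_keys_iff)

text \<open>Both evaluation at a point (\<open>h\<close> the identity) and substitution of polynomials for the
  variables (\<open>h\<close> the embedding of the constants) are instances of the universal property
  of the polynomial ring, so the homomorphism laws are proved once for an arbitrary \<open>h\<close>.\<close>

locale coeff_hom =
  fixes h :: "'k::comm_ring_1 \<Rightarrow> 'b::comm_ring_1"
  assumes hom_add: "h (a + b) = h a + h b"
    and hom_mult: "h (a * b) = h a * h b"
    and hom_one: "h 1 = 1"
begin

lemma hom_zero: "h 0 = 0"
  using hom_add[of 0 0] by simp

definition eval_hom :: "('v::finite \<Rightarrow> 'b) \<Rightarrow> ('v, 'k) mpoly \<Rightarrow> 'b" where
  "eval_hom \<sigma> p = (\<Sum>m\<in>Poly_Mapping.keys p. h (Poly_Mapping.lookup p m) * monom_eval \<sigma> m)"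

lemma eval_hom_superset:
  assumes "finite A" "Poly_Mapping.keys p \<subseteq> A"
  shows "eval_hom \<sigma> p = (\<Sum>m\<in>A. h (Poly_Mapping.lookup p m) * monom_eval \<sigma> m)"
  unfolding eval_hom_def using assms
  by (intro sum.mono_neutral_left) (auto simp: in_keys_iff hom_zero)

lemma eval_hom_add: "eval_hom \<sigma> (p + q) = eval_hom \<sigma> p + eval_hom \<sigma> q"
proof -
  let ?A = "Poly_Mapping.keys p \<union> Poly_Mapping.keys q"
  have "eval_hom \<sigma> r = (\<Sum>m\<in>?A. h (Poly_Mapping.lookup r m) * monom_eval \<sigma> m)"
    if "r \<in> {p, q, p + q}" for r
    using that Poly_Mapping.keys_add[of p q] by (intro eval_hom_superset) auto
  then show ?thesis
    by (simp add: lookup_add hom_add algebra_simps sum.distrib)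
qed

lemma eval_hom_single: "eval_hom \<sigma> (Poly_Mapping.single m c) = h c * monom_eval \<sigma> m"
  using eval_hom_superset[of "{m}" "Poly_Mapping.single m c" \<sigma>] by simp

lemma eval_hom_0 [simp]: "eval_hom \<sigma> 0 = 0"
  by (simp add: eval_hom_def)

lemma eval_hom_mult: "eval_hom \<sigma> (p * q) = eval_hom \<sigma> p * eval_hom \<sigma> q"
proof (induction p rule: poly_mapping_additive_induct)
  case (single m c)
  show ?case
    by (induction q rule: poly_mapping_additive_induct)
      (simp_all add: mult_single eval_hom_single hom_mult monom_eval_add algebra_simps eval_hom_add)
qed (simp add: eval_hom_add algebra_simps)

lemma eval_hom_1 [simp]: "eval_hom \<sigma> 1 = 1"
  using eval_hom_single[of \<sigma> 0 1] by (simp add: hom_one)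

lemma eval_hom_mvar [simp]: "eval_hom \<sigma> (mvar i) = \<sigma> i"
  by (simp add: mvar_def eval_hom_single hom_one)

lemma eval_hom_mconst [simp]: "eval_hom \<sigma> (mconst c) = h c"
  by (simp add: mconst_def eval_hom_single)

lemma eval_hom_power: "eval_hom \<sigma> (p ^ n) = eval_hom \<sigma> p ^ n"
  by (induction n) (auto simp: eval_hom_mult)

lemma eval_hom_sum: "eval_hom \<sigma> (sum f A) = (\<Sum>x\<in>A. eval_hom \<sigma> (f x))"
  by (induction A rule: infinite_finite_induct) (auto simp: eval_hom_add)

lemma eval_hom_prod: "eval_hom \<sigma> (prod f A) = (\<Prod>x\<in>A. eval_hom \<sigma> (f x))"
  by (induction A rule: infinite_finite_induct) (auto simp: eval_hom_mult)

end

interpretation coeff_id: coeff_hom "\<lambda>c. c"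
  by unfold_locales auto

interpretation coeff_mconst: coeff_hom "mconst :: 'k::comm_ring_1 \<Rightarrow> ('v::finite, 'k) mpoly"
  by unfold_locales (auto simp: mconst_def single_add mult_single)

lemma mpoly_eval_eq: "mpoly_eval a p = coeff_id.eval_hom a p"
  by (simp add: mpoly_eval_def coeff_id.eval_hom_def monom_eval_keys)

abbreviation subst_vars ::
    "('v::finite \<Rightarrow> ('w::finite, 'k::comm_ring_1) mpoly) \<Rightarrow> ('v, 'k) mpoly \<Rightarrow> ('w, 'k) mpoly" where
  "subst_vars \<equiv> coeff_mconst.eval_hom"

section \<open>Polynomial functions\<close>

definition polynomial_fun :: "(('v::finite \<Rightarrow> 'k::comm_ring_1) \<Rightarrow> 'k) \<Rightarrow> bool" where
  "polynomial_fun f \<longleftrightarrow> (\<exists>p. \<forall>a. f a = mpoly_eval a p)"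

lemma polynomial_fun_const: "polynomial_fun (\<lambda>a. c)"
  unfolding polynomial_fun_def mpoly_eval_eq
  by (rule exI[of _ "mconst c"]) simp

lemma polynomial_fun_coord: "polynomial_fun (\<lambda>a. a i)"
  unfolding polynomial_fun_def mpoly_eval_eq
  by (rule exI[of _ "mvar i"]) simp

lemma polynomial_fun_add:
  "polynomial_fun f \<Longrightarrow> polynomial_fun g \<Longrightarrow> polynomial_fun (\<lambda>a. f a + g a)"
  unfolding polynomial_fun_def mpoly_eval_eq by (metis coeff_id.eval_hom_add)

lemma polynomial_fun_mult:
  "polynomial_fun f \<Longrightarrow> polynomial_fun g \<Longrightarrow> polynomial_fun (\<lambda>a. f a * g a)"
  unfolding polynomial_fun_def mpoly_eval_eq by (metis coeff_id.eval_hom_mult)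

lemma polynomial_fun_diff:
  "polynomial_fun f \<Longrightarrow> polynomial_fun g \<Longrightarrow> polynomial_fun (\<lambda>a. f a - g a)"
  using polynomial_fun_add[of f "\<lambda>a. (-1) * g a"] polynomial_fun_mult[OF polynomial_fun_const[of "-1"], of g]
  by simp

lemma polynomial_fun_sum:
  "(\<And>x. x \<in> A \<Longrightarrow> polynomial_fun (f x)) \<Longrightarrow> polynomial_fun (\<lambda>a. \<Sum>x\<in>A. f x a)"
  by (induction A rule: infinite_finite_induct)
    (auto intro: polynomial_fun_const polynomial_fun_add)

lemma polynomial_fun_prod:
  "(\<And>x. x \<in> A \<Longrightarrow> polynomial_fun (f x)) \<Longrightarrow> polynomial_fun (\<lambda>a. \<Prod>x\<in>A. f x a)"
  by (induction A rule: infinite_finite_induct)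
    (auto intro: polynomial_fun_const polynomial_fun_mult)

lemma polynomial_fun_det:
  fixes M :: "('v::finite \<Rightarrow> 'k::comm_ring_1) \<Rightarrow> 'k^'n^'n"
  assumes "\<And>i j. polynomial_fun (\<lambda>a. M a $ i $ j)"
  shows "polynomial_fun (\<lambda>a. det (M a))"
  unfolding det_def
  by (intro polynomial_fun_sum polynomial_fun_mult polynomial_fun_const polynomial_fun_prod assms)

text \<open>The loci \<open>F t \<noteq> 0\<close> are open, and so is their union over the parameter \<open>t\<close>. The parameter is
  what allows a condition on pairs \<open>(t, a)\<close> to be turned into the condition on \<open>a\<close> that some
  \<open>t\<close> satisfies it.\<close>

lemma holds_genericallyI:
  fixes F :: "'t \<Rightarrow> ('v::finite \<Rightarrow> 'k::field) \<Rightarrow> 'k"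
  assumes poly: "\<And>t. polynomial_fun (F t)"
    and nonzero: "F t0 a0 \<noteq> 0"
    and P: "\<And>t a. F t a \<noteq> 0 \<Longrightarrow> P a"
  shows "holds_generically P"
proof -
  obtain p where p: "F t a = mpoly_eval a (p t)" for t a
    using poly unfolding polynomial_fun_def by metis
  let ?U = "{a. \<exists>t. F t a \<noteq> 0}"
  have "- ?U = {a. \<forall>q\<in>range p. mpoly_eval a q = 0}" by (auto simp: p)
  then have "zariski_open ?U" unfolding zariski_open_def zariski_closed_def by blast
  then show ?thesis using nonzero P unfolding holds_generically_def by blast
qed

section \<open>Ideals and injectivity of multiplication\<close>

lemma ring_of_type_algebra_simps:
  "carrier ring_of_type_algebra = UNIV"
  "x \<otimes>\<^bsub>ring_of_type_algebra\<^esub> y = x * y"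
  "x \<oplus>\<^bsub>ring_of_type_algebra\<^esub> y = x + y"
  "\<zero>\<^bsub>ring_of_type_algebra\<^esub> = 0"
  "\<one>\<^bsub>ring_of_type_algebra\<^esub> = 1"
  by (simp_all add: ring_of_type_algebra_def)

lemma a_inv_ring_of_type_algebra:
  "\<ominus>\<^bsub>ring_of_type_algebra\<^esub> (x :: 'a::comm_ring_1) = - x"
proof -
  interpret R: cring "ring_of_type_algebra :: 'a ring" by rule
  show ?thesis
    using R.minus_equality[of "- x" x] by (simp add: ring_of_type_algebra_simps)
qed

lemma mem_genideal_range_iff:
  fixes g :: "'r::finite \<Rightarrow> 'a::comm_ring_1"
  shows "x \<in> Idl\<^bsub>ring_of_type_algebra\<^esub> (range g) \<longleftrightarrow> (\<exists>q. x = (\<Sum>j\<in>UNIV. q j * g j))"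
proof -
  let ?R = "ring_of_type_algebra :: 'a ring"
  interpret R: cring ?R by rule
  let ?J = "{x. \<exists>q. x = (\<Sum>j\<in>UNIV. q j * g j)}"
  have I: "ideal (Idl\<^bsub>?R\<^esub> (range g)) ?R"
    by (rule R.genideal_ideal) (simp add: ring_of_type_algebra_simps)
  have gI: "range g \<subseteq> Idl\<^bsub>?R\<^esub> (range g)"
    by (rule R.genideal_self) (simp add: ring_of_type_algebra_simps)
  have "ideal ?J ?R"
  proof (rule idealI)
    show "ring ?R" by (rule R.ring_axioms)
    show "subgroup ?J (add_monoid ?R)"
    proof (rule group.subgroupI)
      show "Group.group (add_monoid ?R)" by (rule R.add.is_group)
      show "?J \<noteq> {}" by blast
    next
      fix x assume "x \<in> ?J"
      then obtain q where "x = (\<Sum>j\<in>UNIV. q j * g j)" by blast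
      then have "- x = (\<Sum>j\<in>UNIV. (- q j) * g j)" by (simp add: sum_negf)
      then show "inv\<^bsub>add_monoid ?R\<^esub> x \<in> ?J"
        using a_inv_ring_of_type_algebra[of x] unfolding a_inv_def mem_Collect_eq by metis
    next
      fix x y assume "x \<in> ?J" "y \<in> ?J"
      then obtain q r where "x = (\<Sum>j\<in>UNIV. q j * g j)" "y = (\<Sum>j\<in>UNIV. r j * g j)" by blast
      then have "x + y = (\<Sum>j\<in>UNIV. (q j + r j) * g j)" by (simp add: sum.distrib algebra_simps)
      then show "x \<otimes>\<^bsub>add_monoid ?R\<^esub> y \<in> ?J" by (auto simp: ring_of_type_algebra_simps)
    qed (auto simp: ring_of_type_algebra_simps)
  next
    fix x y assume "x \<in> ?J"
    then obtain q where "x = (\<Sum>j\<in>UNIV. q j * g j)" by blast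
    then have "y * x = (\<Sum>j\<in>UNIV. (y * q j) * g j)" by (simp add: sum_distrib_left algebra_simps)
    then show "y \<otimes>\<^bsub>?R\<^esub> x \<in> ?J" "x \<otimes>\<^bsub>?R\<^esub> y \<in> ?J"
      by (auto simp: ring_of_type_algebra_simps mult.commute)
  qed
  moreover have "range g \<subseteq> ?J"
  proof safe
    fix j show "\<exists>q. g j = (\<Sum>i\<in>UNIV. q i * g i)"
      by (rule exI[of _ "\<lambda>i. if i = j then 1 else 0"]) (simp add: if_distrib[of "\<lambda>x. x * _"] cong: if_cong)
  qed
  ultimately have "Idl\<^bsub>?R\<^esub> (range g) \<subseteq> ?J" by (rule R.genideal_minimal)
  moreover have "(\<Sum>j\<in>A. q j * g j) \<in> Idl\<^bsub>?R\<^esub> (range g)" for q and A :: "'r set"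
  proof -
    interpret I: ideal "Idl\<^bsub>?R\<^esub> (range g)" ?R by (rule I)
    have "q j * g j \<in> Idl\<^bsub>?R\<^esub> (range g)" for j
      using I.I_l_closed[of "g j" "q j"] gI by (auto simp: ring_of_type_algebra_simps)
    then show ?thesis
      using I.a_closed I.zero_closed
      by (induction A rule: infinite_finite_induct) (auto simp: ring_of_type_algebra_simps)
  qed
  ultimately show ?thesis by blast
qed

lemma inj_on_mult_map:
  fixes I :: "('v, 'k::comm_ring_1) mpoly set"
  assumes I: "ideal I mpoly_ring"
    and cancel: "\<And>f. f \<in> homogeneous d \<Longrightarrow> l * f \<in> I \<Longrightarrow> f \<in> I"
  shows "inj_on (mult_map I l) (graded_part I d)"
proof -
  let ?R = "mpoly_ring :: ('v, 'k) mpoly ring"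
  interpret ideal I ?R by (rule I)
  have mult: "mult_map I l (I +>\<^bsub>?R\<^esub> f) = I +>\<^bsub>?R\<^esub> (l * f)" for f
    using rcoset_mult_add[of l f]
    by (simp add: mult_map_def FactRing_def ring_of_type_algebra_simps)
  have coset_eq: "I +>\<^bsub>?R\<^esub> f = I +>\<^bsub>?R\<^esub> g \<longleftrightarrow> f - g \<in> I" for f g
    using quotient_eq_iff_same_a_r_cos[OF I, of f g]
    by (simp add: ring_of_type_algebra_simps a_minus_def a_inv_ring_of_type_algebra)
  have diff: "f - g \<in> homogeneous d" if "f \<in> homogeneous d" "g \<in> homogeneous d" for f g :: "('v, 'k) mpoly"
    using that by (auto simp: homogeneous_def in_keys_iff lookup_minus)
  show ?thesis
  proof (rule inj_onI)
    fix x y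
    assume "x \<in> graded_part I d" "y \<in> graded_part I d" and eq: "mult_map I l x = mult_map I l y"
    then obtain f g where fg: "x = I +>\<^bsub>?R\<^esub> f" "y = I +>\<^bsub>?R\<^esub> g"
      "f \<in> homogeneous d" "g \<in> homogeneous d"
      unfolding graded_part_def by blast
    have "l * (f - g) \<in> I" using eq by (simp add: fg mult coset_eq right_diff_distrib)
    then show "x = y" using cancel[OF diff[OF fg(3,4)]] by (simp add: fg coset_eq)
  qed
qed

section \<open>Coefficients\<close>

lemma monom_degree_eq: "monom_degree (m :: 'v::finite \<Rightarrow>\<^sub>0 nat) = (\<Sum>i\<in>UNIV. Poly_Mapping.lookup m i)"
  unfolding monom_degree_def by (rule sum.mono_neutral_left) (auto simp: in_keys_iff)

lemma monom_degree_add: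
  "monom_degree (m + n :: 'v::finite \<Rightarrow>\<^sub>0 nat) = monom_degree m + monom_degree n"
  by (simp add: monom_degree_eq lookup_add sum.distrib)

lemma monom_degree_single [simp]: "monom_degree (Poly_Mapping.single i n :: 'v::finite \<Rightarrow>\<^sub>0 nat) = n"
  by (simp add: monom_degree_eq lookup_single when_def)

lemma unit_exp_eq_iff [simp]:
  "Poly_Mapping.single i (Suc 0) = Poly_Mapping.single j (Suc 0) \<longleftrightarrow> i = j"
  by (metis keys_single nat.distinct(1) singleton_inject)

lemma monom_degree_eq_1D:
  assumes "monom_degree (m :: 'v::finite \<Rightarrow>\<^sub>0 nat) = 1"
  obtains i where "m = Poly_Mapping.single i 1"
proof -
  from assms obtain i where i: "Poly_Mapping.lookup m i = 1" "\<And>j. j \<noteq> i \<Longrightarrow> Poly_Mapping.lookup m j = 0"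
    by (auto simp: monom_degree_eq sum_eq_Suc0_iff)
  then have "m = Poly_Mapping.single i 1"
    by (intro poly_mapping_eqI) (auto simp: lookup_single when_def)
  then show thesis by (rule that)
qed

abbreviation unit_exp :: "'v \<Rightarrow> 'v \<Rightarrow>\<^sub>0 nat" where
  "unit_exp i \<equiv> Poly_Mapping.single i 1"

lemma homogeneous_lookup:
  "p \<in> homogeneous d \<Longrightarrow> monom_degree m \<noteq> d \<Longrightarrow> Poly_Mapping.lookup p m = 0"
  by (auto simp: homogeneous_def in_keys_iff)

lemma homogeneous_add: "p \<in> homogeneous d \<Longrightarrow> q \<in> homogeneous d \<Longrightarrow> p + q \<in> homogeneous d"
  using Poly_Mapping.keys_add[of p q] by (auto simp: homogeneous_def)

lemma homogeneous_0: "0 \<in> homogeneous d"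
  by (simp add: homogeneous_def)

lemma homogeneous_sum: "(\<And>x. x \<in> A \<Longrightarrow> f x \<in> homogeneous d) \<Longrightarrow> sum f A \<in> homogeneous d"
  by (induction A rule: infinite_finite_induct) (auto intro: homogeneous_0 homogeneous_add)

lemma homogeneous_mult:
  fixes p q :: "('v::finite, 'k::comm_ring_1) mpoly"
  shows "p \<in> homogeneous d \<Longrightarrow> q \<in> homogeneous e \<Longrightarrow> p * q \<in> homogeneous (d + e)"
  using Poly_Mapping.keys_mult[of p q] by (fastforce simp: homogeneous_def monom_degree_add)

lemma homogeneous_mconst: "mconst c \<in> homogeneous 0"
  by (simp add: homogeneous_def mconst_def monom_degree_def)

lemma homogeneous_1: "(1 :: ('v::finite, 'k::comm_ring_1) mpoly) \<in> homogeneous 0"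
  by (simp add: homogeneous_def monom_degree_def)

lemma homogeneous_power:
  fixes p :: "('v::finite, 'k::comm_ring_1) mpoly"
  shows "p \<in> homogeneous d \<Longrightarrow> p ^ n \<in> homogeneous (n * d)"
  by (induction n) (auto intro: homogeneous_1 homogeneous_mult)

lemma homogeneous_prod:
  fixes f :: "'x \<Rightarrow> ('v::finite, 'k::comm_ring_1) mpoly"
  shows "(\<And>x. x \<in> A \<Longrightarrow> f x \<in> homogeneous (d x)) \<Longrightarrow> prod f A \<in> homogeneous (sum d A)"
  by (induction A rule: infinite_finite_induct) (auto intro: homogeneous_1 homogeneous_mult)

lemma mconst_mult_mvar: "mconst c * mvar i = Poly_Mapping.single (unit_exp i) (c :: 'k::comm_ring_1)"
  by (simp add: mconst_def mvar_def mult_single)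

lemma homogeneous_linear_form: "linear_form a \<in> homogeneous 1"
  unfolding linear_form_def
  by (intro homogeneous_sum) (simp add: mconst_mult_mvar homogeneous_def)

lemma lookup_linear_form [simp]:
  "Poly_Mapping.lookup (linear_form a) (unit_exp i) = a i"
  by (simp add: linear_form_def lookup_sum mconst_mult_mvar lookup_single when_def)

lemma lookup_single_times:
  fixes p :: "('v, 'k::comm_ring_1) mpoly"
  shows "Poly_Mapping.lookup (Poly_Mapping.single k c * p) (k + n) = c * Poly_Mapping.lookup p n"
  by (simp add: lookup_mult lookup_single when_mult)

lemma lookup_single_times_eq_0:
  fixes p :: "('v, 'k::comm_ring_1) mpoly"
  assumes "\<And>n. m \<noteq> k + n"
  shows "Poly_Mapping.lookup (Poly_Mapping.single k c * p) m = 0"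
  using assms by (simp add: lookup_mult lookup_single when_mult)

lemma single_add_minus:
  assumes "0 < Poly_Mapping.lookup m i"
  shows "unit_exp i + (m - unit_exp i) = m"
  using assms by (intro poly_mapping_eqI) (auto simp: lookup_add lookup_minus lookup_single when_def)

text \<open>In degree one above that of \<open>p\<close>, only the linear part of \<open>q\<close> contributes to \<open>q * p\<close>, so the
  cofactors in an ideal membership can stay arbitrary polynomials. Iterated, the formula also
  yields the coefficients of the powers of a linear form.\<close>

lemma lookup_mult_homogeneous:
  fixes p q :: "('v::finite, 'k::comm_ring_1) mpoly"
  assumes p: "p \<in> homogeneous d" and m: "monom_degree m = Suc d"
  shows "Poly_Mapping.lookup (q * p) m =
    (\<Sum>i\<in>Poly_Mapping.keys m. Poly_Mapping.lookup q (unit_exp i) *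
       Poly_Mapping.lookup p (m - unit_exp i))"
proof (induction q rule: poly_mapping_additive_induct)
  case (add q r)
  then show ?case by (simp add: lookup_add distrib_right sum.distrib)
next
  case (single k c)
  show ?case
  proof (cases "\<exists>i. k = unit_exp i")
    case True
    then obtain i where k: "k = unit_exp i" by blast
    have rhs: "(\<Sum>j\<in>Poly_Mapping.keys m. Poly_Mapping.lookup (Poly_Mapping.single k c) (unit_exp j) *
       Poly_Mapping.lookup p (m - unit_exp j)) =
       (if i \<in> Poly_Mapping.keys m then c * Poly_Mapping.lookup p (m - unit_exp i) else 0)"
      by (simp add: k lookup_single when_def if_distrib[of "\<lambda>x. x * _"] cong: if_cong)
    show ?thesis
    proof (cases "i \<in> Poly_Mapping.keys m")
      case True
      then have "k + (m - k) = m" using single_add_minus[of m i] by (simp add: k in_keys_iff)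
      then show ?thesis unfolding rhs using lookup_single_times[of k c p "m - k"] True by (simp add: k)
    next
      case False
      then have "m \<noteq> k + n" for n by (auto simp: k in_keys_iff lookup_add)
      then show ?thesis unfolding rhs using False by (simp add: lookup_single_times_eq_0)
    qed
  next
    case False
    then have "Poly_Mapping.lookup (Poly_Mapping.single k c) (unit_exp j) = 0" for j
      by (auto simp: lookup_single when_def)
    moreover have "Poly_Mapping.lookup (Poly_Mapping.single k c * p) m = 0"
    proof (cases "\<exists>n. m = k + n")
      case True
      then obtain n where n: "m = k + n" by blast
      have "monom_degree k \<noteq> 1" using False monom_degree_eq_1D by metis
      then have "monom_degree n \<noteq> d" using m by (simp add: n monom_degree_add)
      then show ?thesis using p by (simp add: n lookup_single_times homogeneous_lookup)
    qed (auto intro: lookup_single_times_eq_0)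
    ultimately show ?thesis by simp
  qed
qed

lemma keys_add_nat: "Poly_Mapping.keys (m + n :: 'v \<Rightarrow>\<^sub>0 nat) = Poly_Mapping.keys m \<union> Poly_Mapping.keys n"
  by (auto simp: in_keys_iff lookup_add)

context
  fixes a :: "'v::finite \<Rightarrow> 'k::comm_ring_1"
begin

lemma linear_form_power: "linear_form a ^ n \<in> homogeneous n"
  using homogeneous_power[OF homogeneous_linear_form[of a], of n] by simp

lemma lookup_square_same: "Poly_Mapping.lookup (linear_form a ^ 2) (unit_exp i + unit_exp i) = a i ^ 2"
proof -
  have "Poly_Mapping.lookup (linear_form a * linear_form a) (unit_exp i + unit_exp i) = a i ^ 2"
    by (subst lookup_mult_homogeneous[OF homogeneous_linear_form])
      (simp_all add: monom_degree_add keys_add_nat lookup_linear_form[simplified] power2_eq_square del: One_nat_def)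
  then show ?thesis by (simp add: power2_eq_square)
qed

lemma lookup_square_diff:
  assumes "i \<noteq> j"
  shows "Poly_Mapping.lookup (linear_form a ^ 2) (unit_exp i + unit_exp j) = 2 * a i * a j"
proof -
  have "unit_exp i + unit_exp j - unit_exp j = unit_exp i" "unit_exp i + unit_exp j - unit_exp i = unit_exp j"
    by simp_all
  then have "Poly_Mapping.lookup (linear_form a * linear_form a) (unit_exp i + unit_exp j) = 2 * a i * a j"
    using assms
    by (subst lookup_mult_homogeneous[OF homogeneous_linear_form])
      (simp_all add: monom_degree_add keys_add_nat del: One_nat_def)
  then show ?thesis by (simp add: power2_eq_square)
qed

lemma lookup_cube_2_1:
  assumes "i \<noteq> j"
  shows "Poly_Mapping.lookup (linear_form a ^ 3) (unit_exp i + unit_exp i + unit_exp j) = 3 * a i ^ 2 * a j"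
proof -
  have *: "unit_exp i + unit_exp i + unit_exp j - unit_exp j = unit_exp i + unit_exp i"
    "unit_exp i + unit_exp i + unit_exp j - unit_exp i = unit_exp i + unit_exp j"
    using assms by (auto intro!: poly_mapping_eqI simp: lookup_add lookup_minus lookup_single when_def)
  have "Poly_Mapping.lookup (linear_form a * linear_form a ^ 2) (unit_exp i + unit_exp i + unit_exp j) = 3 * a i ^ 2 * a j"
    using assms
    by (subst lookup_mult_homogeneous[OF linear_form_power],
        simp_all add: * monom_degree_add keys_add_nat lookup_square_same lookup_square_diff del: One_nat_def, (simp_all add: power2_eq_square algebra_simps)?)
  then show ?thesis by (simp add: power2_eq_square power3_eq_cube algebra_simps)
qed

lemma lookup_cube_1_1_1:
  assumes "i \<noteq> j" "i \<noteq> k" "j \<noteq> k"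
  shows "Poly_Mapping.lookup (linear_form a ^ 3) (unit_exp i + unit_exp j + unit_exp k) = 6 * a i * a j * a k"
proof -
  have *: "unit_exp i + unit_exp j + unit_exp k - unit_exp k = unit_exp i + unit_exp j"
    "unit_exp i + unit_exp j + unit_exp k - unit_exp i = unit_exp j + unit_exp k"
    "unit_exp i + unit_exp j + unit_exp k - unit_exp j = unit_exp i + unit_exp k"
    using assms by (auto intro!: poly_mapping_eqI simp: lookup_add lookup_minus lookup_single when_def)
  have "Poly_Mapping.lookup (linear_form a * linear_form a ^ 2) (unit_exp i + unit_exp j + unit_exp k) = 6 * a i * a j * a k"
    using assms
    by (subst lookup_mult_homogeneous[OF linear_form_power],
        simp_all add: * monom_degree_add keys_add_nat lookup_square_diff del: One_nat_def, (simp_all add: algebra_simps)?)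
  then show ?thesis by (simp add: power2_eq_square power3_eq_cube algebra_simps)
qed

lemma lookup_mult_cube_2_2:
  assumes "i \<noteq> j"
  shows "Poly_Mapping.lookup (q * linear_form a ^ 3) (unit_exp i + unit_exp i + unit_exp j + unit_exp j) =
    3 * a i * a j * (Poly_Mapping.lookup q (unit_exp i) * a j + Poly_Mapping.lookup q (unit_exp j) * a i)"
proof -
  have *: "unit_exp i + unit_exp i + unit_exp j + unit_exp j - unit_exp j = unit_exp i + unit_exp i + unit_exp j"
    "unit_exp i + unit_exp i + unit_exp j + unit_exp j - unit_exp i = unit_exp j + unit_exp j + unit_exp i"
    using assms by (auto intro!: poly_mapping_eqI simp: lookup_add lookup_minus lookup_single when_def)
  show ?thesis
    using assms
    by (subst lookup_mult_homogeneous[OF linear_form_power],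
        simp_all add: * monom_degree_add keys_add_nat lookup_cube_2_1 del: One_nat_def, (simp_all add: power2_eq_square algebra_simps)?)
qed

lemma lookup_mult_cube_2_1_1:
  assumes "i \<noteq> j" "i \<noteq> k" "j \<noteq> k"
  shows "Poly_Mapping.lookup (q * linear_form a ^ 3) (unit_exp i + unit_exp i + unit_exp j + unit_exp k) =
    3 * a i * (2 * Poly_Mapping.lookup q (unit_exp i) * a j * a k + 
      Poly_Mapping.lookup q (unit_exp j) * a i * a k + Poly_Mapping.lookup q (unit_exp k) * a i * a j)"
proof -
  have *: "unit_exp i + unit_exp i + unit_exp j + unit_exp k - unit_exp k = unit_exp i + unit_exp i + unit_exp j"
    "unit_exp i + unit_exp i + unit_exp j + unit_exp k - unit_exp j = unit_exp i + unit_exp i + unit_exp k"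
    "unit_exp i + unit_exp i + unit_exp j + unit_exp k - unit_exp i = unit_exp i + unit_exp j + unit_exp k"
    using assms by (auto intro!: poly_mapping_eqI simp: lookup_add lookup_minus lookup_single when_def)
  show ?thesis
    using assms
    by (subst lookup_mult_homogeneous[OF linear_form_power],
        simp_all add: * monom_degree_add keys_add_nat lookup_cube_2_1 lookup_cube_1_1_1
         del: One_nat_def, (simp_all add: power2_eq_square algebra_simps)?)
qed

end

section \<open>The linear system for the coefficients\<close>

text \<open>
  The equations \<open>E1\<close> and \<open>E2\<close> say that the coefficients of \<open>x\<^sub>i\<^sup>2x\<^sub>j\<^sup>2\<close> and of \<open>x\<^sub>i\<^sup>2x\<^sub>jx\<^sub>k\<close> vanish in
  \<open>UA\<^sup>3 + VB\<^sup>3\<close>, where \<open>U, V, A, B\<close> are the linear forms with coefficients \<open>u, v, a, b\<close>.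
  In terms of \<open>p = u/a\<close>, \<open>r = v/b\<close>, \<open>\<beta> = b/a\<close> they express \<open>p\<^sub>i + p\<^sub>j\<close> and
  \<open>(p\<^sub>i + p\<^sub>j) + (p\<^sub>i + p\<^sub>k)\<close> through \<open>r\<close>. Eliminating \<open>p\<close> leaves an expression that contains the factor
  \<open>\<beta>\<^sub>j - \<beta>\<^sub>k\<close>, and cancelling it gives \<open>\<beta>\<^sub>j(r\<^sub>i + r\<^sub>j) = \<beta>\<^sub>k(r\<^sub>i + r\<^sub>k)\<close>. This determines \<open>r\<^sub>i\<close>
  from \<open>j\<close> and \<open>k\<close> alone, so with four indices \<open>r\<close> is constant, and then it is zero because the
  \<open>\<beta>\<close> differ.
\<close>

lemma quartic_system_trivial:
  fixes a b u v :: "'i \<Rightarrow> 'k::field_char_0"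
  assumes card: "4 \<le> card S"
    and a0: "\<And>i. i \<in> S \<Longrightarrow> a i \<noteq> 0" and b0: "\<And>i. i \<in> S \<Longrightarrow> b i \<noteq> 0"
    and indep: "\<And>i j. i \<in> S \<Longrightarrow> j \<in> S \<Longrightarrow> i \<noteq> j \<Longrightarrow> a i * b j \<noteq> a j * b i"
    and E1: "\<And>i j. i \<in> S \<Longrightarrow> j \<in> S \<Longrightarrow> i \<noteq> j \<Longrightarrow>
      3 * a i * a j * (u i * a j + u j * a i) + 3 * b i * b j * (v i * b j + v j * b i) = 0"
    and E2: "\<And>i j k. i \<in> S \<Longrightarrow> j \<in> S \<Longrightarrow> k \<in> S \<Longrightarrow> i \<noteq> j \<Longrightarrow> i \<noteq> k \<Longrightarrow> j \<noteq> k \<Longrightarrow>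
      3 * a i * (2 * u i * a j * a k + u j * a i * a k + u k * a i * a j) +
      3 * b i * (2 * v i * b j * b k + v j * b i * b k + v k * b i * b j) = 0"
    and i: "i \<in> S"
  shows "u i = 0 \<and> v i = 0"
proof -
  define p where "p i = u i / a i" for i
  define r where "r i = v i / b i" for i
  define \<beta> where "\<beta> i = b i / a i" for i
  have u: "u i = a i * p i" and v: "v i = a i * \<beta> i * r i" and b: "b i = a i * \<beta> i" if "i \<in> S" for i
    using that a0 b0 by (auto simp: p_def r_def \<beta>_def)
  have \<beta>0: "\<beta> i \<noteq> 0" if "i \<in> S" for i using that a0 b0 by (auto simp: \<beta>_def)
  have \<beta>_inj: "\<beta> i \<noteq> \<beta> j" if "i \<in> S" "j \<in> S" "i \<noteq> j" for i j
    using indep[OF that] a0[OF that(1)] a0[OF that(2)] by (auto simp: \<beta>_def field_simps)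
  have P: "p i + p j = - (\<beta> i ^ 2 * \<beta> j ^ 2 * (r i + r j))" if "i \<in> S" "j \<in> S" "i \<noteq> j" for i j
  proof -
    have "3 * a i ^ 2 * a j ^ 2 * ((p i + p j) + \<beta> i ^ 2 * \<beta> j ^ 2 * (r i + r j)) = 0"
      using E1[OF that] that by (simp add: u v b power2_eq_square algebra_simps)
    then show ?thesis using a0 that by (simp add: eq_neg_iff_add_eq_0)
  qed
  have Q: "(2 * p i + p j + p k) + \<beta> i ^ 2 * \<beta> j * \<beta> k * (2 * r i + r j + r k) = 0"
    if "i \<in> S" "j \<in> S" "k \<in> S" "i \<noteq> j" "i \<noteq> k" "j \<noteq> k" for i j k
  proof -
    have "3 * a i ^ 2 * a j * a k * ((2 * p i + p j + p k) + \<beta> i ^ 2 * \<beta> j * \<beta> k * (2 * r i + r j + r k)) = 0"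
      using E2[OF that] that by (simp add: u v b power2_eq_square algebra_simps)
    then show ?thesis using a0 that by simp
  qed
  have key: "\<beta> j * (r i + r j) = \<beta> k * (r i + r k)"
    if "i \<in> S" "j \<in> S" "k \<in> S" "i \<noteq> j" "i \<noteq> k" "j \<noteq> k" for i j k
  proof -
    have "\<beta> i ^ 2 * (\<beta> j - \<beta> k) * (\<beta> j * (r i + r j) - \<beta> k * (r i + r k)) =
       \<beta> i ^ 2 * \<beta> j ^ 2 * (r i + r j) + \<beta> i ^ 2 * \<beta> k ^ 2 * (r i + r k)
       - \<beta> i ^ 2 * \<beta> j * \<beta> k * (2 * r i + r j + r k)"
      by (simp add: power2_eq_square algebra_simps)
    also have "\<dots> = - (p i + p j) - (p i + p k) - \<beta> i ^ 2 * \<beta> j * \<beta> k * (2 * r i + r j + r k)"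
      using that by (simp add: P)
    also have "\<dots> = - ((2 * p i + p j + p k) + \<beta> i ^ 2 * \<beta> j * \<beta> k * (2 * r i + r j + r k))"
      by (simp add: algebra_simps)
    also have "\<dots> = 0" using Q[OF that] by simp
    finally show ?thesis using \<beta>0[OF that(1)] \<beta>_inj[OF that(2,3,6)] by simp
  qed
  have other: "\<exists>j k. j \<in> S \<and> k \<in> S \<and> j \<noteq> k \<and> j \<notin> {i, i'} \<and> k \<notin> {i, i'}" for i i'
  proof -
    have "card S \<le> card (S - {i, i'}) + card {i, i'}"
      using card diff_card_le_card_Diff[of "{i, i'}" S] by simp
    moreover have "card {i, i'} \<le> 2" by (simp add: card_insert_if)
    ultimately have "\<not> card (S - {i, i'}) \<le> 1" using card by linarith
    moreover have "finite (S - {i, i'})" using card by (metis card.infinite finite_Diff not_numeral_le_zero)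
    ultimately show ?thesis unfolding card_le_Suc0_iff_eq[OF \<open>finite (S - {i, i'})\<close>] One_nat_def by blast
  qed
  have r_eq: "r i = r i'" if "i \<in> S" "i' \<in> S" for i i'
  proof -
    obtain j k where jk: "j \<in> S" "k \<in> S" "j \<noteq> k" "j \<notin> {i, i'}" "k \<notin> {i, i'}" using other by blast
    have "(\<beta> j - \<beta> k) * r l = \<beta> k * r k - \<beta> j * r j" if "l \<in> {i, i'}" for l
      using key[of l j k] jk that \<open>i \<in> S\<close> \<open>i' \<in> S\<close> by (auto simp: algebra_simps)
    from this[of i] this[of i'] have "(\<beta> j - \<beta> k) * r i = (\<beta> j - \<beta> k) * r i'" by simp
    then show ?thesis using \<beta>_inj[OF jk(1-3)] by simp
  qed
  have r0: "r i = 0" if "i \<in> S" for i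
  proof -
    obtain j k where jk: "j \<in> S" "k \<in> S" "j \<noteq> k" "j \<noteq> i" "k \<noteq> i" using other[of i i] by blast
    have "\<beta> j * (2 * r i) = \<beta> k * (2 * r i)"
      using key[of i j k] jk that r_eq[of i j] r_eq[of i k] by simp
    then show ?thesis using \<beta>_inj[OF jk(1-3)] by simp
  qed
  obtain j k where jk: "j \<in> S" "k \<in> S" "j \<noteq> k" "j \<noteq> i" "k \<noteq> i" using other[of i i] by blast
  have "p i + p j = 0" "p i + p k = 0" "p j + p k = 0" using P jk i r0 by simp_all
  moreover have "2 * p i = (p i + p j) + (p i + p k) - (p j + p k)" by simp
  ultimately have "2 * p i = 0" by (simp only: add_0 diff_self)
  then have "p i = 0" by simp
  then show ?thesis using u[OF i] v[OF i] r0[OF i] by simp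
qed

section \<open>Cancelling a variable\<close>

lemma mvar_power: "(mvar i :: ('v, 'k::comm_ring_1) mpoly) ^ n = Poly_Mapping.single (Poly_Mapping.single i n) 1"
  by (induction n) (simp_all add: mvar_def mult_single single_add[symmetric])

lemma mem_pure_power_ideal:
  fixes g :: "('v::finite, 'k::comm_ring_1) mpoly"
  assumes "\<And>m. m \<in> Poly_Mapping.keys g \<Longrightarrow> \<exists>i\<in>S. n \<le> Poly_Mapping.lookup m i"
  shows "\<exists>p. g = (\<Sum>i\<in>S. p i * mvar i ^ n)"
proof -
  define J where "J = {g :: ('v, 'k) mpoly. \<exists>p. g = (\<Sum>i\<in>S. p i * mvar i ^ n)}"
  have zero: "0 \<in> J" unfolding J_def by (auto intro: exI[of _ "\<lambda>_. 0"])
  have add: "f + h \<in> J" if "f \<in> J" "h \<in> J" for f h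
  proof -
    from that obtain p q where "f = (\<Sum>i\<in>S. p i * mvar i ^ n)" "h = (\<Sum>i\<in>S. q i * mvar i ^ n)"
      unfolding J_def by blast
    then have "f + h = (\<Sum>i\<in>S. (p i + q i) * mvar i ^ n)" by (simp add: sum.distrib algebra_simps)
    then show ?thesis unfolding J_def by (intro CollectI exI[of _ "\<lambda>i. p i + q i"])
  qed
  have mono: "Poly_Mapping.single m c \<in> J" if m: "m \<in> Poly_Mapping.keys g" for m c
  proof -
    obtain i where i: "i \<in> S" "n \<le> Poly_Mapping.lookup m i" using assms m by blast
    have "m - Poly_Mapping.single i n + Poly_Mapping.single i n = m"
      using i(2) by (intro poly_mapping_eqI) (auto simp: lookup_add lookup_minus lookup_single when_def)
    then have "Poly_Mapping.single m c = Poly_Mapping.single (m - Poly_Mapping.single i n) c * mvar i ^ n"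
      by (simp add: mvar_power mult_single)
    also have "\<dots> = (\<Sum>j\<in>S. (if j = i then Poly_Mapping.single (m - Poly_Mapping.single i n) c else 0) * mvar j ^ n)"
      using i(1) by (simp add: if_distrib[of "\<lambda>x. x * _"] cong: if_cong)
    finally show ?thesis unfolding J_def by (intro CollectI exI)
  qed
  have "(\<Sum>m\<in>A. Poly_Mapping.single m (Poly_Mapping.lookup g m)) \<in> J"
    if "finite A" "A \<subseteq> Poly_Mapping.keys g" for A
    using that by (induction A) (auto intro: zero add mono)
  moreover have "(\<Sum>m\<in>Poly_Mapping.keys g. Poly_Mapping.single m (Poly_Mapping.lookup g m)) = g"
    by (rule poly_mapping_eqI) (auto simp: lookup_sum lookup_single when_def in_keys_iff)
  ultimately have "g \<in> J" by (metis finite_keys order_refl)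
  then show ?thesis unfolding J_def by blast
qed

lemma lookup_pure_power_ideal:
  fixes q :: "'v::finite \<Rightarrow> ('v, 'k::comm_ring_1) mpoly"
  assumes "\<And>i. i \<in> S \<Longrightarrow> Poly_Mapping.lookup m i < n"
  shows "Poly_Mapping.lookup (\<Sum>i\<in>S. q i * mvar i ^ n) m = 0"
proof -
  have "Poly_Mapping.lookup (mvar i ^ n * q i) m = 0" if "i \<in> S" for i
    unfolding mvar_power
    by (rule lookup_single_times_eq_0) (use assms[OF that] in \<open>auto simp: lookup_add\<close>)
  then show ?thesis by (simp add: lookup_sum mult.commute)
qed

lemma lookup_mult_cube_var:
  fixes s :: "('v::finite, 'k::comm_ring_1) mpoly"
  assumes "monom_degree m = 3" "\<And>i. i \<noteq> z \<Longrightarrow> Poly_Mapping.lookup s (unit_exp i) = 0"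
  shows "Poly_Mapping.lookup (s * linear_form a ^ 3) (unit_exp z + m) =
    Poly_Mapping.lookup s (unit_exp z) * Poly_Mapping.lookup (linear_form a ^ 3) m"
proof -
  have "Poly_Mapping.lookup (s * linear_form a ^ 3) (unit_exp z + m) =
    (\<Sum>i\<in>Poly_Mapping.keys (unit_exp z + m). Poly_Mapping.lookup s (unit_exp i) *
       Poly_Mapping.lookup (linear_form a ^ 3) (unit_exp z + m - unit_exp i))"
    by (rule lookup_mult_homogeneous[OF linear_form_power]) (simp add: monom_degree_add assms(1))
  also have "\<dots> = (\<Sum>i\<in>{z}. Poly_Mapping.lookup s (unit_exp i) *
       Poly_Mapping.lookup (linear_form a ^ 3) (unit_exp z + m - unit_exp i))"
    by (rule sum.mono_neutral_right) (use assms(2) in \<open>auto simp: keys_add_nat\<close>)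
  finally show ?thesis by simp
qed

text \<open>
  The monomials of degree four without \<open>z\<close> and with all exponents at most two occur neither in
  \<open>mvar z * f\<close> nor in the ideal of the cubes of variables, so they yield the linear system
  above for the linear parts of \<open>s\<close> and \<open>t\<close>. Hence these linear parts are multiples \<open>c\<close>, \<open>d\<close> of the
  variable \<open>z\<close>. The degree four part of the equation then says that \<open>mvar z\<close> times
  \<open>f - c A\<^sup>3 - d B\<^sup>3\<close> lies in a monomial ideal whose generators do not involve \<open>z\<close>, where
  \<open>mvar z\<close> can be cancelled. Here \<open>A\<close>, \<open>B\<close> are the linear forms with coefficients \<open>a\<close>, \<open>b\<close>.
\<close>

lemma cancel_variable:
  fixes f s t :: "('v::finite, 'k::field_char_0) mpoly" and z :: 'v
  assumes card: "5 \<le> CARD('v)"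
    and a0: "\<And>i. i \<noteq> z \<Longrightarrow> a i \<noteq> 0" and b0: "\<And>i. i \<noteq> z \<Longrightarrow> b i \<noteq> 0"
    and indep: "\<And>i j. i \<noteq> z \<Longrightarrow> j \<noteq> z \<Longrightarrow> i \<noteq> j \<Longrightarrow> a i * b j \<noteq> a j * b i"
    and f: "f \<in> homogeneous 3"
    and eq: "mvar z * f = (\<Sum>i\<in>UNIV - {z}. q i * mvar i ^ 3) + s * linear_form a ^ 3 + t * linear_form b ^ 3"
  shows "\<exists>p c d. f = (\<Sum>i\<in>UNIV - {z}. p i * mvar i ^ 3) + mconst c * linear_form a ^ 3 + mconst d * linear_form b ^ 3"
proof -
  let ?S = "UNIV - {z}"
  let ?lk = Poly_Mapping.lookup
  have mvar_z: "mvar z = Poly_Mapping.single (unit_exp z) 1" by (simp add: mvar_def)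
  \<comment> \<open>Exponents below 3 away from \<open>z\<close> keep a monomial outside the ideal of the cubes \<open>mvar i ^ 3\<close>.\<close>
  have reduced: "?lk (mvar z * f) m = ?lk (s * linear_form a ^ 3) m + ?lk (t * linear_form b ^ 3) m"
    if "\<And>i. i \<noteq> z \<Longrightarrow> ?lk m i < 3" for m
    using that lookup_pure_power_ideal[of "UNIV - {z}" m 3 q] by (simp add: eq lookup_add)
  have free_of_z: "?lk (mvar z * f) m = 0" if "?lk m z = 0" for m
    unfolding mvar_z by (rule lookup_single_times_eq_0) (use that in \<open>auto simp: lookup_add\<close>)
  have relation: "?lk (s * linear_form a ^ 3) m + ?lk (t * linear_form b ^ 3) m = 0"
    if "\<forall>i. ?lk m i < 3" "?lk m z = 0" for m
    using reduced[of m] free_of_z[of m] that by simp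
  have uv: "?lk s (unit_exp i) = 0 \<and> ?lk t (unit_exp i) = 0" if "i \<noteq> z" for i
  proof (rule quartic_system_trivial[where a = a and b = b and S = ?S])
    show "4 \<le> card ?S" using card by (simp add: card_Diff_singleton)
  next
    fix i j assume "i \<in> ?S" "j \<in> ?S" "i \<noteq> j"
    then show "3 * a i * a j * (?lk s (unit_exp i) * a j + ?lk s (unit_exp j) * a i) +
       3 * b i * b j * (?lk t (unit_exp i) * b j + ?lk t (unit_exp j) * b i) = 0"
      using relation[of "unit_exp i + unit_exp i + unit_exp j + unit_exp j"]
      unfolding lookup_mult_cube_2_2[OF \<open>i \<noteq> j\<close>] by (auto simp: lookup_add lookup_single when_def)
  next
    fix i j k assume "i \<in> ?S" "j \<in> ?S" "k \<in> ?S" and ne: "i \<noteq> j" "i \<noteq> k" "j \<noteq> k"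
    then show "3 * a i * (2 * ?lk s (unit_exp i) * a j * a k +
         ?lk s (unit_exp j) * a i * a k + ?lk s (unit_exp k) * a i * a j) +
       3 * b i * (2 * ?lk t (unit_exp i) * b j * b k +
         ?lk t (unit_exp j) * b i * b k + ?lk t (unit_exp k) * b i * b j) = 0"
      using relation[of "unit_exp i + unit_exp i + unit_exp j + unit_exp k"]
      unfolding lookup_mult_cube_2_1_1[OF ne] by (auto simp: lookup_add lookup_single when_def)
  qed (use that a0 b0 indep in auto)
  define c where "c = ?lk s (unit_exp z)"
  define d where "d = ?lk t (unit_exp z)"
  define g where "g = f - mconst c * linear_form a ^ 3 - mconst d * linear_form b ^ 3"
  have "\<exists>i\<in>?S. 3 \<le> ?lk m i" if "m \<in> Poly_Mapping.keys g" for m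
  proof (rule ccontr)
    assume "\<not> ?thesis"
    then have m: "?lk m i < 3" if "i \<noteq> z" for i using that by (auto simp: not_le)
    have mc: "?lk (mconst e * p) m = e * ?lk p m" for e and p :: "('v, 'k) mpoly"
      using lookup_single_times[of 0 e p m] by (simp add: mconst_def)
    have "?lk g m = 0"
    proof (cases "monom_degree m = 3")
      case True
      have "?lk f m = ?lk (mvar z * f) (unit_exp z + m)"
        unfolding mvar_z lookup_single_times by simp
      also have "\<dots> = ?lk (s * linear_form a ^ 3) (unit_exp z + m) + ?lk (t * linear_form b ^ 3) (unit_exp z + m)"
        by (rule reduced) (use m in \<open>auto simp: lookup_add lookup_single\<close>)
      also have "\<dots> = c * ?lk (linear_form a ^ 3) m + d * ?lk (linear_form b ^ 3) m"
        unfolding c_def d_def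
        using uv lookup_mult_cube_var[OF True, of z s a] lookup_mult_cube_var[OF True, of z t b] by simp
      finally show ?thesis by (simp add: g_def lookup_minus mc)
    next
      case False
      then show ?thesis
        using homogeneous_lookup[OF f] homogeneous_lookup[OF linear_form_power, of m 3 a]
          homogeneous_lookup[OF linear_form_power, of m 3 b]
        by (simp add: g_def lookup_minus mc)
    qed
    then show False using that by (simp add: in_keys_iff)
  qed
  then obtain p where "g = (\<Sum>i\<in>?S. p i * mvar i ^ 3)"
    using mem_pure_power_ideal[of g ?S 3] by blast
  then have "f = (\<Sum>i\<in>?S. p i * mvar i ^ 3) + mconst c * linear_form a ^ 3 + mconst d * linear_form b ^ 3"
    by (simp add: g_def algebra_simps)
  then show ?thesis by blast
qed

section \<open>Change of coordinates\<close>

lemma linear_form_linear: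
  "linear_form (\<lambda>k. \<Sum>i\<in>S. c i * g i k) = (\<Sum>i\<in>S. mconst (c i) * linear_form (g i))"
proof -
  have mult: "mconst (a * b) = (mconst a * mconst b :: ('v::finite, 'k::comm_ring_1) mpoly)" for a b
    by (rule coeff_mconst.hom_mult)
  have "linear_form (\<lambda>k. \<Sum>i\<in>S. c i * g i k) = (\<Sum>k\<in>UNIV. \<Sum>i\<in>S. mconst (c i) * (mconst (g i k) * mvar k))"
    unfolding linear_form_def sum_distrib_right
    by (induction S rule: infinite_finite_induct)
      (simp_all add: coeff_mconst.hom_zero coeff_mconst.hom_add mult sum.distrib algebra_simps)
  also have "\<dots> = (\<Sum>i\<in>S. mconst (c i) * linear_form (g i))"
    unfolding linear_form_def by (subst sum.swap) (simp add: sum_distrib_left)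
  finally show ?thesis .
qed

lemma linear_form_unit:
  fixes i :: "'v::finite"
  shows "linear_form (\<lambda>k. if k = i then 1 else 0) = (mvar i :: ('v, 'k::comm_ring_1) mpoly)"
proof -
  have "mconst (if k = i then 1 else 0) * mvar k = (if k = i then mvar k else 0 :: ('v, 'k) mpoly)" for k
    by (simp add: coeff_mconst.hom_one coeff_mconst.hom_zero)
  then show ?thesis by (simp add: linear_form_def)
qed

text \<open>The columns of \<open>A\<close> are the linear forms that replace the variables; with this convention linear
  forms are transformed by multiplying \<open>A\<close> with their coefficient vectors.\<close>

definition coord_change :: "'k::comm_ring_1^'v^'v \<Rightarrow> ('v::finite, 'k) mpoly \<Rightarrow> ('v, 'k) mpoly" where
  "coord_change A = subst_vars (\<lambda>i. linear_form (\<lambda>k. A $ k $ i))"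

lemma coord_change_mvar: "coord_change A (mvar i) = linear_form (\<lambda>k. A $ k $ i)"
  by (simp add: coord_change_def)

lemma coord_change_mult: "coord_change A (p * q) = coord_change A p * coord_change A q"
  by (simp add: coord_change_def coeff_mconst.eval_hom_mult)

lemma coord_change_add: "coord_change A (p + q) = coord_change A p + coord_change A q"
  by (simp add: coord_change_def coeff_mconst.eval_hom_add)

lemma coord_change_power: "coord_change A (p ^ n) = coord_change A p ^ n"
  by (simp add: coord_change_def coeff_mconst.eval_hom_power)

lemma coord_change_sum: "coord_change A (sum g S) = (\<Sum>x\<in>S. coord_change A (g x))"
  by (simp add: coord_change_def coeff_mconst.eval_hom_sum)

lemma coord_change_mconst: "coord_change A (mconst c) = mconst c"
  by (simp add: coord_change_def)

lemma coord_change_linear_form: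
  "coord_change A (linear_form (\<lambda>k. x $ k)) = linear_form (\<lambda>k. (A *v x) $ k)"
proof -
  have "linear_form (\<lambda>k. (A *v x) $ k) = linear_form (\<lambda>k. \<Sum>i\<in>UNIV. x $ i * A $ k $ i)"
    by (simp add: matrix_vector_mult_def mult.commute)
  then show ?thesis
    unfolding linear_form_linear
    by (simp add: linear_form_def[of "\<lambda>k. x $ k"] coord_change_sum coord_change_mult coord_change_mconst coord_change_mvar)
qed

lemma coord_change_inverse:
  assumes "A ** B = mat 1"
  shows "coord_change A (coord_change B p) = p"
proof (induction p rule: poly_mapping_additive_induct)
  case (single m c)
  have "coord_change A (linear_form (\<lambda>k. B $ k $ i)) = mvar i" for i
  proof -
    have "(\<lambda>k. (A *v column i B) $ k) = (\<lambda>k. (A ** B) $ k $ i)"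
      by (simp add: column_def matrix_vector_mult_def matrix_matrix_mult_def)
    also have "\<dots> = (\<lambda>k. if k = i then 1 else 0)" by (simp add: assms mat_def)
    finally show ?thesis
      using coord_change_linear_form[of A "column i B"] by (simp add: column_def linear_form_unit)
  qed
  then have "coord_change A (coord_change B (Poly_Mapping.single m c)) = mconst c * monom_eval mvar m"
    by (simp add: coord_change_def[of B] coeff_mconst.eval_hom_single coord_change_mult coord_change_mconst
        monom_eval_def coord_change_power coord_change_def[of A] coeff_mconst.eval_hom_prod coeff_mconst.eval_hom_mult
        coeff_mconst.eval_hom_power)
  also have "monom_eval mvar m = Poly_Mapping.single m (1::'a)"
  proof -
    have "(\<Prod>i\<in>S. mvar i ^ Poly_Mapping.lookup m i :: ('b, 'a) mpoly) =
      Poly_Mapping.single (\<Sum>i\<in>S. Poly_Mapping.single i (Poly_Mapping.lookup m i)) 1" for S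
      by (induction S rule: infinite_finite_induct) (simp_all add: mvar_power mult_single)
    moreover have "(\<Sum>i\<in>UNIV. Poly_Mapping.single i (Poly_Mapping.lookup m i)) = m"
      by (rule poly_mapping_eqI) (simp add: lookup_sum lookup_single when_def)
    ultimately show ?thesis by (simp add: monom_eval_def)
  qed
  finally show ?case by (simp add: mconst_def mult_single)
qed (simp add: coord_change_add)

lemma homogeneous_coord_change:
  assumes "p \<in> homogeneous d"
  shows "coord_change A p \<in> homogeneous d"
  unfolding coord_change_def coeff_mconst.eval_hom_def
proof (rule homogeneous_sum)
  fix m assume "m \<in> Poly_Mapping.keys p"
  then have "monom_degree m = d" using assms by (simp add: homogeneous_def)
  moreover have "monom_eval (\<lambda>i. linear_form (\<lambda>k. A $ k $ i)) m \<in> homogeneous (monom_degree m)"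
    unfolding monom_eval_def monom_degree_eq by (intro homogeneous_prod linear_form_power)
  ultimately show "mconst (Poly_Mapping.lookup p m) * monom_eval (\<lambda>i. linear_form (\<lambda>k. A $ k $ i)) m \<in> homogeneous d"
    using homogeneous_mult[OF homogeneous_mconst] by force
qed

lemma cancel_linear_form:
  fixes A :: "'k::field_char_0^'v^'v" and z :: 'v
  assumes card: "5 \<le> CARD('v::finite)"
    and inv: "invertible A"
    and a0: "\<And>i. i \<noteq> z \<Longrightarrow> a $ i \<noteq> 0" and b0: "\<And>i. i \<noteq> z \<Longrightarrow> b $ i \<noteq> 0"
    and indep: "\<And>i j. i \<noteq> z \<Longrightarrow> j \<noteq> z \<Longrightarrow> i \<noteq> j \<Longrightarrow> a $ i * b $ j \<noteq> a $ j * b $ i"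
    and f: "f \<in> homogeneous 3"
    and eq: "linear_form (\<lambda>k. A $ k $ z) * f = (\<Sum>i\<in>UNIV - {z}. q i * linear_form (\<lambda>k. A $ k $ i) ^ 3)
      + s * linear_form (\<lambda>k. (A *v a) $ k) ^ 3 + t * linear_form (\<lambda>k. (A *v b) $ k) ^ 3"
  shows "\<exists>p c d. f = (\<Sum>i\<in>UNIV - {z}. p i * linear_form (\<lambda>k. A $ k $ i) ^ 3)
      + c * linear_form (\<lambda>k. (A *v a) $ k) ^ 3 + d * linear_form (\<lambda>k. (A *v b) $ k) ^ 3"
proof -
  obtain B where AB: "A ** B = mat 1" and BA: "B ** A = mat 1"
    using inv unfolding invertible_def by blast
  let ?\<phi> = "coord_change A" and ?\<psi> = "coord_change B"
  have \<psi>_col: "?\<psi> (linear_form (\<lambda>k. A $ k $ i)) = mvar i" for i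
    using coord_change_inverse[OF BA, of "mvar i"] by (simp add: coord_change_mvar)
  have \<psi>_vec: "?\<psi> (linear_form (\<lambda>k. (A *v x) $ k)) = linear_form (\<lambda>k. x $ k)" for x
    using coord_change_inverse[OF BA, of "linear_form (\<lambda>k. x $ k)"] by (simp add: coord_change_linear_form)
  have "mvar z * ?\<psi> f = (\<Sum>i\<in>UNIV - {z}. ?\<psi> (q i) * mvar i ^ 3)
      + ?\<psi> s * linear_form (\<lambda>k. a $ k) ^ 3 + ?\<psi> t * linear_form (\<lambda>k. b $ k) ^ 3"
    using arg_cong[OF eq, of ?\<psi>]
    by (simp add: coord_change_mult coord_change_add coord_change_sum coord_change_power \<psi>_col \<psi>_vec)
  from cancel_variable[OF card a0 b0 indep homogeneous_coord_change[OF f] this]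
  obtain p c d where "?\<psi> f = (\<Sum>i\<in>UNIV - {z}. p i * mvar i ^ 3)
      + mconst c * linear_form (\<lambda>k. a $ k) ^ 3 + mconst d * linear_form (\<lambda>k. b $ k) ^ 3"
    by blast
  from arg_cong[OF this, of ?\<phi>]
  have "f = (\<Sum>i\<in>UNIV - {z}. ?\<phi> (p i) * linear_form (\<lambda>k. A $ k $ i) ^ 3)
      + mconst c * linear_form (\<lambda>k. (A *v a) $ k) ^ 3 + mconst d * linear_form (\<lambda>k. (A *v b) $ k) ^ 3"
    by (simp add: coord_change_inverse[OF AB] coord_change_mult coord_change_add coord_change_sum
        coord_change_power coord_change_mconst coord_change_mvar coord_change_linear_form)
  then show ?thesis by (intro exI[of _ "\<lambda>i. ?\<phi> (p i)"] exI)
qed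

section \<open>The genericity condition\<close>

text \<open>The numerator in Cramer's rule for the \<open>i\<close>-th coordinate of \<open>y\<close> with respect to the columns of
  \<open>A\<close>. It is a polynomial in the data, unlike the coordinate itself.\<close>

definition cramer_det :: "'k::comm_ring_1^'v^'v \<Rightarrow> 'v::finite \<Rightarrow> ('v \<Rightarrow> 'k) \<Rightarrow> 'k" where
  "cramer_det A i y = det (\<chi> k j. if j = i then y k else A $ k $ j)"

lemma cramer_det_mult:
  fixes A :: "'k::field^'v^'v"
  shows "cramer_det A i (\<lambda>k. (A *v x) $ k) = x $ i * det A"
  unfolding cramer_det_def by (rule cramer_lemma)

text \<open>The hypotheses of \<open>cancel_linear_form\<close> on a basis and two further linear forms, as the non-vanishing
  of a single polynomial: the coordinates \<open>a\<close>, \<open>b\<close> of \<open>y\<close>, \<open>w\<close> and their minors have been multiplied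
  by powers of \<open>det A\<close> to clear denominators.\<close>

definition general_position ::
    "'v \<Rightarrow> 'k::comm_ring_1^'v^'v \<Rightarrow> ('v::finite \<Rightarrow> 'k) \<Rightarrow> ('v \<Rightarrow> 'k) \<Rightarrow> 'k" where
  "general_position z A y w = det A *
     (\<Prod>i\<in>UNIV - {z}. cramer_det A i y * cramer_det A i w *
       (\<Prod>j\<in>UNIV - {z, i}. cramer_det A i y * cramer_det A j w - cramer_det A j y * cramer_det A i w))"

lemma polynomial_fun_if:
  "polynomial_fun f \<Longrightarrow> polynomial_fun g \<Longrightarrow> polynomial_fun (\<lambda>a. if P then f a else g a)"
  by (cases P) simp_all

lemma polynomial_fun_general_position:
  fixes A :: "('u::finite \<Rightarrow> 'k::comm_ring_1) \<Rightarrow> 'k^'v^'v"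
  assumes A: "\<And>k j. polynomial_fun (\<lambda>c. A c $ k $ j)"
    and y: "\<And>k. polynomial_fun (\<lambda>c. y c k)" and w: "\<And>k. polynomial_fun (\<lambda>c. w c k)"
  shows "polynomial_fun (\<lambda>c. general_position z (A c) (y c) (w c))"
proof -
  have cramer: "polynomial_fun (\<lambda>c. cramer_det (A c) i (x c))" if "\<And>k. polynomial_fun (\<lambda>c. x c k)" for i x
    unfolding cramer_det_def by (rule polynomial_fun_det) (auto intro: polynomial_fun_if A that)
  show ?thesis
    unfolding general_position_def
    by (intro polynomial_fun_mult polynomial_fun_diff polynomial_fun_prod polynomial_fun_det cramer[OF y] cramer[OF w] A)
qed

lemma general_position_coordinates:
  fixes A :: "'k::field^'v^'v" and z :: "'v::finite"
  assumes "general_position z A y w \<noteq> 0"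
  obtains a b where "invertible A" "y = (\<lambda>k. (A *v a) $ k)" "w = (\<lambda>k. (A *v b) $ k)"
    "\<forall>i. i \<noteq> z \<longrightarrow> a $ i \<noteq> 0" "\<forall>i. i \<noteq> z \<longrightarrow> b $ i \<noteq> 0"
    "\<forall>i j. i \<noteq> z \<longrightarrow> j \<noteq> z \<longrightarrow> i \<noteq> j \<longrightarrow> a $ i * b $ j \<noteq> a $ j * b $ i"
proof -
  have cr: "cramer_det A i y \<noteq> 0" "cramer_det A i w \<noteq> 0" if "i \<noteq> z" for i
    using assms that by (auto simp: general_position_def)
  have minor: "cramer_det A i y * cramer_det A j w - cramer_det A j y * cramer_det A i w \<noteq> 0"
    if "i \<noteq> z" "j \<noteq> z" "i \<noteq> j" for i j
    using assms that by (auto simp: general_position_def)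
  have "det A \<noteq> 0" using assms by (auto simp: general_position_def)
  then have inv: "invertible A" by (simp add: invertible_det_nz)
  then obtain B where B: "A ** B = mat 1" unfolding invertible_def by blast
  define a where "a = B *v (\<chi> k. y k)"
  define b where "b = B *v (\<chi> k. w k)"
  have y: "y = (\<lambda>k. (A *v a) $ k)" and w: "w = (\<lambda>k. (A *v b) $ k)"
    by (simp_all add: a_def b_def matrix_vector_mul_assoc B)
  have cy: "cramer_det A i y = a $ i * det A" and cw: "cramer_det A i w = b $ i * det A" for i
    by (simp_all add: y w cramer_det_mult)
  show thesis
  proof (rule that[OF inv y w])
    show "\<forall>i. i \<noteq> z \<longrightarrow> a $ i \<noteq> 0" "\<forall>i. i \<noteq> z \<longrightarrow> b $ i \<noteq> 0"
      using cr by (auto simp: cy cw)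
    show "\<forall>i j. i \<noteq> z \<longrightarrow> j \<noteq> z \<longrightarrow> i \<noteq> j \<longrightarrow> a $ i * b $ j \<noteq> a $ j * b $ i"
      using minor by (auto simp: cy cw algebra_simps)
  qed
qed

section \<open>Cubes of general linear forms\<close>

text \<open>The forms are indexed by \<open>'v option\<close>: \<open>None\<close> and \<open>Some z\<close> for the two forms that get expanded in
  the basis, which consists of the remaining ones and, at position \<open>z\<close>, of the multiplier \<open>l\<close>.\<close>

theorem cubes_WLP_in_degree_3:
  assumes card_v: "5 \<le> CARD('v::finite)" and card_r: "CARD('r::finite) = CARD('v) + 1"
  shows "holds_generically (\<lambda>c :: 'r \<times> 'v \<Rightarrow> 'k::field_char_0.
    WLP_in_degree (Idl\<^bsub>mpoly_ring\<^esub> (range (\<lambda>j. linear_form (curry c j) ^ 3))) 3)"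
proof -
  have "card (UNIV :: 'v option set) = card (UNIV :: 'r set)" using card_r by simp
  then obtain h :: "'v option \<Rightarrow> 'r" where h: "bij h"
    using finite_same_card_bij[of "UNIV :: 'v option set" "UNIV :: 'r set"] by auto
  obtain z :: 'v where True by simp
  define A :: "('r \<times> 'v \<Rightarrow> 'k) \<Rightarrow> ('v \<Rightarrow> 'k) \<Rightarrow> 'k^'v^'v" where
    "A c l = (\<chi> k i. if i = z then l k else c (h (Some i), k))" for c l
  define F where "F l c = general_position z (A c l) (\<lambda>k. c (h (Some z), k)) (\<lambda>k. c (h None, k))" for l c
  have A: "A c l $ k $ i = (if i = z then l k else c (h (Some i), k))" for c l k i
    by (simp add: A_def)
  have split: "(\<Sum>j\<in>UNIV. G j) = (\<Sum>i\<in>UNIV - {z}. G (h (Some i))) + G (h (Some z)) + G (h None)"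
    for G :: "'r \<Rightarrow> ('v, 'k) mpoly"
  proof -
    have "(\<Sum>j\<in>UNIV. G j) = (\<Sum>x\<in>UNIV. G (h x))" by (rule sum.reindex_bij_betw[OF h, symmetric])
    also have "\<dots> = G (h None) + (\<Sum>i\<in>UNIV. G (h (Some i)))"
      by (simp add: UNIV_option_conv sum.reindex)
    also have "(\<Sum>i\<in>UNIV. G (h (Some i))) = G (h (Some z)) + (\<Sum>i\<in>UNIV - {z}. G (h (Some i)))"
      by (rule sum.remove) auto
    finally show ?thesis by (simp add: algebra_simps)
  qed
  have poly_c: "polynomial_fun (\<lambda>c. F l c)" for l
    unfolding F_def
    by (rule polynomial_fun_general_position) (auto simp: A intro: polynomial_fun_if polynomial_fun_coord polynomial_fun_const)
  have poly_l: "polynomial_fun (\<lambda>l. F l c)" for c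
    unfolding F_def
    by (rule polynomial_fun_general_position) (auto simp: A intro: polynomial_fun_if polynomial_fun_coord polynomial_fun_const)
  \<comment> \<open>The variables as basis, the sum of all variables, and a form with distinct positive integer coefficients.\<close>
  have witness: "\<exists>l c. F l c \<noteq> 0"
  proof -
    obtain num :: "'v \<Rightarrow> nat" where num: "inj num"
      using finite_imp_inj_to_nat_seg[of "UNIV :: 'v set"] by auto
    define l :: "'v \<Rightarrow> 'k" where "l k = (if k = z then 1 else 0)" for k
    define c :: "'r \<times> 'v \<Rightarrow> 'k" where "c = (\<lambda>(j, k). case inv_into UNIV h j of None \<Rightarrow> of_nat (Suc (num k))
      | Some i \<Rightarrow> if i = z \<or> k = i then 1 else 0)"
    have c: "c (h None, k) = of_nat (Suc (num k))" "c (h (Some i), k) = (if i = z \<or> k = i then 1 else 0)" for i k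
      using h by (simp_all add: c_def bij_is_inj)
    have "A c l = mat 1" by (simp add: A_def mat_def c l_def vec_eq_iff)
    moreover have "cramer_det (mat 1) i y = y i" for i and y :: "'v \<Rightarrow> 'k"
      using cramer_det_mult[of "mat 1" i "\<chi> k. y k"] by simp
    ultimately have "F l c \<noteq> 0"
      using num by (auto simp: F_def general_position_def c inj_eq simp del: of_nat_Suc)
    then show ?thesis by blast
  qed
  have inj: "inj_on (mult_map I (linear_form l)) (graded_part I 3)"
    if nz: "F l c \<noteq> 0" and I_def: "I = Idl\<^bsub>mpoly_ring\<^esub> (range (\<lambda>j. linear_form (curry c j) ^ 3))" for l c I
  proof (rule inj_on_mult_map)
    interpret R: cring "mpoly_ring :: ('v, 'k) mpoly ring" by rule
    show "ideal I mpoly_ring"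
      unfolding I_def by (rule R.genideal_ideal) (simp add: ring_of_type_algebra_simps)
  next
    fix f :: "('v, 'k) mpoly"
    assume f: "f \<in> homogeneous 3" and "linear_form l * f \<in> I"
    then obtain q where q: "linear_form l * f = (\<Sum>j\<in>UNIV. q j * linear_form (curry c j) ^ 3)"
      unfolding I_def mem_genideal_range_iff by blast
    from nz[unfolded F_def] obtain a b where inv: "invertible (A c l)"
      and y: "(\<lambda>k. c (h (Some z), k)) = (\<lambda>k. (A c l *v a) $ k)"
      and w: "(\<lambda>k. c (h None, k)) = (\<lambda>k. (A c l *v b) $ k)"
      and ab: "\<forall>i. i \<noteq> z \<longrightarrow> a $ i \<noteq> 0" "\<forall>i. i \<noteq> z \<longrightarrow> b $ i \<noteq> 0"
      "\<forall>i j. i \<noteq> z \<longrightarrow> j \<noteq> z \<longrightarrow> i \<noteq> j \<longrightarrow> a $ i * b $ j \<noteq> a $ j * b $ i"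
      by (rule general_position_coordinates)
    have cols: "linear_form (\<lambda>k. A c l $ k $ z) = linear_form l"
      "\<And>i. i \<noteq> z \<Longrightarrow> linear_form (\<lambda>k. A c l $ k $ i) = linear_form (curry c (h (Some i)))"
      by (auto simp: A curry_def)
    have yw: "linear_form (\<lambda>k. (A c l *v a) $ k) = linear_form (curry c (h (Some z)))"
      "linear_form (\<lambda>k. (A c l *v b) $ k) = linear_form (curry c (h None))"
      unfolding y[symmetric] w[symmetric] by (auto simp: curry_def)
    have "\<exists>p d e. f = (\<Sum>i\<in>UNIV - {z}. p i * linear_form (\<lambda>k. A c l $ k $ i) ^ 3)
      + d * linear_form (\<lambda>k. (A c l *v a) $ k) ^ 3 + e * linear_form (\<lambda>k. (A c l *v b) $ k) ^ 3"
      by (rule cancel_linear_form[OF card_v inv ab[rule_format] f,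
          where q = "\<lambda>i. q (h (Some i))" and s = "q (h (Some z))" and t = "q (h None)"])
        (simp_all add: cols yw q split)
    then obtain p d e where f_eq: "f = (\<Sum>i\<in>UNIV - {z}. p i * linear_form (curry c (h (Some i))) ^ 3)
      + d * linear_form (curry c (h (Some z))) ^ 3 + e * linear_form (curry c (h None)) ^ 3"
      by (auto simp: cols yw)
    define q' where "q' j = (case inv_into UNIV h j of None \<Rightarrow> e | Some i \<Rightarrow> if i = z then d else p i)" for j
    have q': "q' (h None) = e" "q' (h (Some i)) = (if i = z then d else p i)" for i
      using h by (simp_all add: q'_def bij_is_inj)
    have "f = (\<Sum>j\<in>UNIV. q' j * linear_form (curry c j) ^ 3)"
      unfolding split f_eq by (simp add: q')
    then show "f \<in> I" unfolding I_def mem_genideal_range_iff by blast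
  qed
  obtain l0 c0 where "F l0 c0 \<noteq> 0" using witness by blast
  show ?thesis
  proof (rule holds_genericallyI[of F, OF poly_c \<open>F l0 c0 \<noteq> 0\<close>])
    fix l1 c assume "F l1 c \<noteq> 0"
    show "WLP_in_degree (Idl\<^bsub>mpoly_ring\<^esub> (range (\<lambda>j. linear_form (curry c j) ^ 3))) 3"
      unfolding WLP_in_degree_def
      by (rule holds_genericallyI[of "\<lambda>_::unit. \<lambda>l. F l c", OF poly_l \<open>F l1 c \<noteq> 0\<close>]) (use inj in blast)
  qed
qed

theorem mainTheorem1:
  shows "holds_generically (\<lambda>c :: 8 \<times> 7 \<Rightarrow> complex.
    WLP_in_degree (Idl\<^bsub>mpoly_ring\<^esub> (range (\<lambda>j. linear_form (curry c j) ^ 3))) 3)"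
  by (rule cubes_WLP_in_degree_3) simp_all

end
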